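(* Let $\beta^*\in\mathbb{R}^p$ have at most $s$ non-zero entries and let $\mathcal{S}=\{i:(\beta^* )_i\neq 0\}$ be its support. Let $L_n$ be a function with domain $\mathrm{dom}\,L_n\subseteq\mathbb{R}^p$, let $\tau_n>0$, and suppose that the minimizer $$\check\beta_n:=\arg\min_{\beta\in\mathbb{R}^p:\ \beta_{\mathcal{S}^c}=0}\ L_n(\beta)+\tau_n\|\beta\|_1$$ exists and is unique. Let $\lambda_{\min}>0$, $\alpha\in(0,1]$, $K\ge 0$, and put $$r_n:=\frac{\alpha+4}{\lambda_{\min}}\sqrt{s}\,\tau_n .$$ Assume that: 1. $L_n$ is convex, three times continuously differentiable, and satisfies the $(\beta^*,\mathcal{N}_{\beta^*})$-LSSC with parameter $K$ for some convex (open) set $\mathcal{N}_{\beta^*}\subseteq\mathrm{dom}\,L_n$ containing $\beta^*$; 2. $[\nabla^2L_n(\beta^* )]_{\mathcal{S},\mathcal{S}}\ge\lambda_{\min}I$ in the positive-semidefinite order; 3. $\left\|[\nabla^2L_n(\beta^* )]_{\mathcal{S}^c,\mathcal{S}}\,[\nabla^2L_n(\beta^* )]_{\mathcal{S},\mathcal{S}}^{-1}\right\|_\infty<1-\alpha$; 4. $\min\{|(\beta^* )_k|:k\in\mathcal{S}\}>r_n$; 5. $\displaystyle \tau_n<\frac{\lambda_{\min}^2}{4(\alpha+4)^2}\,\frac{\alpha}{Ks}$ (vacuous if $Ks=0$); 6. $\|\nabla L_n(\beta^* )\|_\infty\le\frac{\alpha}{4}\tau_n$; 7. $\{\beta\in\mathbb{R}^p:\|\beta-\beta^*\|_2\le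 r_n,\ \beta_{\mathcal{S}^c}=0\}\subseteq\mathcal{N}_{\beta^*}$. Then the minimizer $$\hat\beta_n:=\arg\min_{\beta\in\mathbb{R}^p}\ L_n(\beta)+\tau_n\|\beta\|_1$$ exists and is unique, and it satisfies $\mathrm{sign}\,\hat\beta_n=\mathrm{sign}\,\beta^*$ and $\|\hat\beta_n-\beta^*\|_2\le r_n$.
   Context: Minimizations are over points of $\mathrm{dom}\,L_n$ (i.e. $L_n=+\infty$ outside its domain); the domain is taken to be open so that derivatives make sense. For a vector $v$ and index set $\mathcal{S}\subseteq\{1,\dots,p\}$, $v_{\mathcal{S}}$ is the sub-vector on $\mathcal{S}$ and $\mathcal{S}^c=\{1,\dots,p\}\setminus\mathcal{S}$; $A_{\mathcal{S},\mathcal{S}}$ and $A_{\mathcal{S}^c,\mathcal{S}}$ are the corresponding sub-matrices of $A$. $\mathrm{sign}\,v$ is taken entrywise, with $\mathrm{sign}\,0=0$. For a vector, $\|\cdot\|_q$ is the $\ell_q$-norm; for a matrix, $\|\cdot\|_\infty$ is the operator norm induced by the vector $\ell_\infty$-norm (maximum absolute row sum). Third derivative: for $f\in C^3$, $D^3f(x)[u,v]$ denotes the vector such that $\langle D^3f(x)[u,v],w\rangle=D^3f(x)[u,v,w]$ for all $w\in\mathbb{R}^p$, where $D^3f(x)$ is the third Fréchet derivative viewed as a symmetric trilinear form. Local structured smoothness condition (LSSC): let $f\in C^3(\mathrm{dom}\,f)$, $\mathrm{dom}\,f\subseteq\mathbb{R}^p$, $x^*\in\mathrm{dom}\,f$,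 and let $\mathcal{N}_{x^*}\subseteq\mathrm{dom}\,f$ be an open set containing $x^*$. Then $f$ satisfies the $(x^*,\mathcal{N}_{x^*})$-LSSC with parameter $K\ge0$ if $\|D^3f(x^*+\delta)[u,u]\|_\infty\le K\|u\|_2^2$ for all $\delta\in\mathbb{R}^p$ with $x^*+\delta\in\mathcal{N}_{x^*}$ and all $u\in\mathbb{R}^p$ with $u_{\mathcal{S}^c}=0$, where $\mathcal{S}=\mathrm{supp}\,x^*$. *)

theory Defs
  imports "HOL-Analysis.Analysis"
begin

text \<open>Frechet derivative as a map into the space of bounded linear maps, so that it can be
  iterated. \<^const>\<open>Blinfun\<close> is only meaningful at points of differentiability; see
  \<open>has_derivative_fderiv\<close>.\<close>

definition fderiv :: "('a::real_normed_vector \<Rightarrow> 'b::real_normed_vector) \<Rightarrow> 'a \<Rightarrow> 'a \<Rightarrow>\<^sub>L 'b" where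
  "fderiv f x = Blinfun (frechet_derivative f (at x))"

abbreviation fderiv2 :: "('a::real_normed_vector \<Rightarrow> 'b::real_normed_vector) \<Rightarrow> 'a \<Rightarrow> 'a \<Rightarrow>\<^sub>L 'a \<Rightarrow>\<^sub>L 'b" where
  "fderiv2 f \<equiv> fderiv (fderiv f)"

abbreviation fderiv3 :: "('a::real_normed_vector \<Rightarrow> 'b::real_normed_vector) \<Rightarrow> 'a \<Rightarrow> 'a \<Rightarrow>\<^sub>L 'a \<Rightarrow>\<^sub>L 'a \<Rightarrow>\<^sub>L 'b" where
  "fderiv3 f \<equiv> fderiv (fderiv2 f)"

lemma has_derivative_fderiv:
  assumes "f differentiable at x"
  shows "(f has_derivative blinfun_apply (fderiv f x)) (at x)"
  using assms unfolding fderiv_def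
  by (metis bounded_linear_Blinfun_apply frechet_derivative_works has_derivative_bounded_linear)

text \<open>Used for open \<open>U\<close> only.\<close>

definition C3_on :: "('a::real_normed_vector \<Rightarrow> 'b::real_normed_vector) \<Rightarrow> 'a set \<Rightarrow> bool" where
  "C3_on f U \<longleftrightarrow>
     (\<forall>x\<in>U. f differentiable at x \<and> fderiv f differentiable at x \<and> fderiv2 f differentiable at x)
     \<and> continuous_on U (fderiv3 f)"

text \<open>The vector representing a linear functional with respect to the inner product.\<close>

definition riesz :: "((real ^ 'p) \<Rightarrow>\<^sub>L real) \<Rightarrow> real ^ 'p" where
  "riesz \<phi> = (\<chi> i. \<phi> (axis i 1))"

lemma inner_riesz: "riesz \<phi> \<bullet> w = \<phi> w"
proof -
  have "\<phi> w = \<phi> (\<Sum>i\<in>UNIV. (w $ i) *\<^sub>R axis i 1)"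
    by (metis (no_types, lifting) basis_expansion scalar_mult_eq_scaleR sum.cong)
  also have "\<dots> = (\<Sum>i\<in>UNIV. (w $ i) * \<phi> (axis i 1))"
    by (simp add: blinfun.sum_right blinfun.scaleR_right)
  finally show ?thesis
    by (simp add: riesz_def inner_vec_def mult.commute)
qed

definition gradient :: "(real ^ 'p \<Rightarrow> real) \<Rightarrow> real ^ 'p \<Rightarrow> real ^ 'p" where
  "gradient f x = riesz (fderiv f x)"

lemma gderiv_gradient: "f differentiable at x \<Longrightarrow> GDERIV f x :> gradient f x"
  by (simp add: gderiv_def gradient_def inner_commute[of _ "riesz _"] inner_riesz has_derivative_fderiv)

definition hessian :: "(real ^ 'p \<Rightarrow> real) \<Rightarrow> real ^ 'p \<Rightarrow> real ^ 'p ^ 'p" where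
  "hessian f x = (\<chi> i j. fderiv2 f x (axis i 1) (axis j 1))"

lemma inner_hessian: "u \<bullet> (hessian f x *v v) = fderiv2 f x u v"
proof -
  have exp: "(\<Sum>i\<in>UNIV. (w $ i) *\<^sub>R axis i 1) = w" for w :: "real ^ 'p"
    using basis_expansion[of w] by (simp add: scalar_mult_eq_scaleR)
  have "fderiv2 f x (\<Sum>i\<in>UNIV. (u $ i) *\<^sub>R axis i 1) v = u \<bullet> (hessian f x *v v)"
  proof -
    have "fderiv2 f x (axis i 1) v = (hessian f x *v v) $ i" for i
    proof -
      have "fderiv2 f x (axis i 1) v
          = fderiv2 f x (axis i 1) (\<Sum>j\<in>UNIV. (v $ j) *\<^sub>R axis j 1)"
        by (simp only: exp)
      also have "\<dots> = (\<Sum>j\<in>UNIV. v $ j * fderiv2 f x (axis i 1) (axis j 1))"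
        by (simp only: blinfun.sum_right blinfun.scaleR_right real_scaleR_def)
      finally show ?thesis
        by (simp add: matrix_vector_mult_def hessian_def mult.commute)
    qed
    then show ?thesis
      by (simp add: blinfun.sum_right blinfun.sum_left blinfun.scaleR_right blinfun.scaleR_left
          inner_vec_def)
  qed
  then show ?thesis by (simp only: exp)
qed

text \<open>\<open>third_deriv_vec f x u v\<close> is the vector \<open>D\<^sup>3f(x)[u,v]\<close>.\<close>

definition third_deriv_vec :: "(real ^ 'p \<Rightarrow> real) \<Rightarrow> real ^ 'p \<Rightarrow> real ^ 'p \<Rightarrow> real ^ 'p \<Rightarrow> real ^ 'p" where
  "third_deriv_vec f x u v = riesz (fderiv3 f x u v)"

lemma inner_third_deriv_vec: "third_deriv_vec f x u v \<bullet> w = fderiv3 f x u v w"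
  by (simp add: third_deriv_vec_def inner_riesz)

definition vsupp :: "real ^ 'p \<Rightarrow> 'p set" where
  "vsupp x = {i. x $ i \<noteq> 0}"

text \<open>Entrywise sign; the library's \<^const>\<open>sgn\<close> on \<open>real ^ 'p\<close> is \<open>x / norm x\<close> instead.\<close>

definition sign_vec :: "real ^ 'p \<Rightarrow> real ^ 'p" where
  "sign_vec x = (\<chi> i. sgn (x $ i))"

definition l1_norm :: "real ^ 'p \<Rightarrow> real" where
  "l1_norm x = (\<Sum>i\<in>UNIV. \<bar>x $ i\<bar>)"

text \<open>Matrix norm induced by the vector maximum norm \<^const>\<open>infnorm\<close>
  (the library's \<^const>\<open>onorm\<close> is induced by the Euclidean norm).\<close>

definition matrix_infnorm :: "real ^ 'n ^ 'm \<Rightarrow> real" where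
  "matrix_infnorm A = (SUP v\<in>{v. infnorm v \<le> 1}. infnorm (A *v v))"

lemma infnorm_le_iff: "infnorm (x :: real ^ 'n) \<le> c \<longleftrightarrow> (\<forall>i. \<bar>x $ i\<bar> \<le> c)"
  unfolding infnorm_Max
  by (subst Max_le_iff) (auto simp: Basis_vec_def inner_axis)

lemma matrix_infnorm_eq_row_sum:
  "matrix_infnorm A = Max (range (\<lambda>i. \<Sum>j\<in>UNIV. \<bar>A $ i $ j\<bar>))"  (is "_ = ?M")
  unfolding matrix_infnorm_def
proof (rule cSup_eq_maximum)
  let ?R = "\<lambda>i. \<Sum>j\<in>UNIV. \<bar>A $ i $ j\<bar>"
  have le: "infnorm (A *v v) \<le> ?M" if "infnorm v \<le> 1" for v
    unfolding infnorm_le_iff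
  proof
    fix i
    have "\<bar>(A *v v) $ i\<bar> \<le> (\<Sum>j\<in>UNIV. \<bar>A $ i $ j * v $ j\<bar>)"
      by (simp add: matrix_vector_mult_def)
    also have "\<dots> \<le> ?R i"
      using that by (intro sum_mono) (simp add: infnorm_le_iff abs_mult mult_left_le)
    also have "\<dots> \<le> ?M" by simp
    finally show "\<bar>(A *v v) $ i\<bar> \<le> ?M" .
  qed
  then show "x \<le> ?M" if "x \<in> (\<lambda>v. infnorm (A *v v)) ` {v. infnorm v \<le> 1}" for x
    using that by auto
  have "?M \<in> range ?R" by (rule Max_in) auto
  then obtain i where i: "?M = ?R i" by (rule rangeE)
  define v :: "real ^ 'a" where "v = (\<chi> j. sgn (A $ i $ j))"
  have v: "infnorm v \<le> 1" by (simp add: infnorm_le_iff v_def abs_sgn_eq)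
  have "?R i = (A *v v) $ i"
    by (simp add: matrix_vector_mult_def v_def abs_sgn)
  also have "\<dots> \<le> infnorm (A *v v)"
    using infnorm_le_iff[of "A *v v" "infnorm (A *v v)"] by (meson abs_ge_self order.trans order_refl)
  finally have "infnorm (A *v v) = ?M" using le[OF v] i by linarith
  then show "?M \<in> (\<lambda>v. infnorm (A *v v)) ` {v. infnorm v \<le> 1}" using v by force
qed

text \<open>The sub-matrix with rows in \<open>I\<close> and columns in \<open>J\<close>, extended by zero so that it stays in
  \<open>real ^ 'p ^ 'p\<close>. Products, \<^const>\<open>matrix_infnorm\<close> and positive semidefiniteness are unaffected
  by this extension; the identity on the index set \<open>I\<close> becomes \<open>submat I I (mat 1)\<close>.\<close>

definition submat :: "'p set \<Rightarrow> 'p set \<Rightarrow> real ^ 'p ^ 'p \<Rightarrow> real ^ 'p ^ 'p" where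
  "submat I J A = (\<chi> i j. if i \<in> I \<and> j \<in> J then A $ i $ j else 0)"

text \<open>\<open>block_inv I A\<close> is the inverse of the \<open>I \<times> I\<close> block of \<open>A\<close>, again extended by zero.\<close>

definition is_block_inv :: "'p set \<Rightarrow> real ^ 'p ^ 'p \<Rightarrow> real ^ 'p ^ 'p \<Rightarrow> bool" where
  "is_block_inv I A B \<longleftrightarrow> submat I I B = B
     \<and> submat I I A ** B = submat I I (mat 1) \<and> B ** submat I I A = submat I I (mat 1)"

definition block_inv :: "'p set \<Rightarrow> real ^ 'p ^ 'p \<Rightarrow> real ^ 'p ^ 'p" where
  "block_inv I A = (THE B. is_block_inv I A B)"

lemma submat_id_mult: "submat I I (mat 1) ** submat I J A = submat I J A"
proof -
  have "submat I I (mat 1) $ i $ k * submat I J A $ k $ j = (if k = i then submat I J A $ i $ j else 0)" for i j k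
    by (auto simp: submat_def mat_def)
  then show ?thesis by (simp add: vec_eq_iff matrix_matrix_mult_def)
qed

lemma submat_mult_id: "submat J I A ** submat I I (mat 1) = submat J I A"
proof -
  have "submat J I A $ i $ k * submat I I (mat 1) $ k $ j = (if k = j then submat J I A $ i $ j else 0)" for i j k
    by (auto simp: submat_def mat_def)
  then show ?thesis by (simp add: vec_eq_iff matrix_matrix_mult_def)
qed

lemma block_inv_eq:
  assumes "is_block_inv I A B"
  shows "block_inv I A = B"
  unfolding block_inv_def
proof (rule the_equality)
  fix C assume "is_block_inv I A C"
  with assms show "C = B"
    unfolding is_block_inv_def by (metis matrix_mul_assoc submat_id_mult submat_mult_id)
qed (rule assms)

definition psd :: "real ^ 'p ^ 'p \<Rightarrow> bool" where
  "psd A \<longleftrightarrow> transpose A = A \<and> (\<forall>x. 0 \<le> x \<bullet> (A *v x))"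

definition loewner_le :: "real ^ 'p ^ 'p \<Rightarrow> real ^ 'p ^ 'p \<Rightarrow> bool" where
  "loewner_le A B \<longleftrightarrow> psd (B - A)"

text \<open>Local structured smoothness at \<open>xs\<close> on the neighbourhood \<open>N\<close>. The standing requirements
  (\<open>f\<close> is \<open>C\<^sup>3\<close> on an open domain containing the open set \<open>N\<close>, \<open>xs \<in> N\<close>, \<open>0 \<le> K\<close>) are
  stated where the condition is used.\<close>

definition LSSC :: "(real ^ 'p \<Rightarrow> real) \<Rightarrow> real ^ 'p \<Rightarrow> (real ^ 'p) set \<Rightarrow> real \<Rightarrow> bool" where
  "LSSC f xs N K \<longleftrightarrow>
     (\<forall>\<delta> u. xs + \<delta> \<in> N \<longrightarrow> (\<forall>i\<in>- vsupp xs. u $ i = 0) \<longrightarrow>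
        infnorm (third_deriv_vec f (xs + \<delta>) u u) \<le> K * (norm u)\<^sup>2)"

end

theory Submission
  imports Defs
begin

text \<open>
  The proof is a primal-dual witness argument: the minimizer \<open>b\<close> over the vectors supported on
  \<open>S\<close> is shown to be the minimizer over the whole domain.

  The vector \<open>b\<close> is close to \<open>\<beta>s\<close>. On the sphere of radius \<open>r\<close> around \<open>\<beta>s\<close> inside the
  coordinate subspace, the Hessian contributes at least \<open>lam * r\<^sup>2 / 2\<close> to the objective, while
  gradient, penalty and third-order remainder together take away less, because they are all
  bounded by multiples of \<open>\<tau>\<close> times the \<open>\<ell>\<^sub>1\<close>-norm, and \<open>r\<close> is chosen so that
  \<open>lam * r = (\<alpha> + 4) * sqrt s * \<tau>\<close>
  (\<open>lasso_objective_larger_on_sphere\<close>). Hence the objective on the sphere exceeds its value at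
  \<open>\<beta>s\<close>, and by convexity \<open>b\<close> lies inside the sphere. As all non-zero entries of \<open>\<beta>s\<close> exceed
  \<open>r\<close> in modulus, \<open>b\<close> and \<open>\<beta>s\<close> have the same signs.

  All entries of \<open>b\<close> on \<open>S\<close> are therefore non-zero, so the objective is differentiable at \<open>b\<close>
  in these directions and the gradient of \<open>L\<close> there equals \<open>- \<tau> * sgn b\<close>. A first-order expansion
  of the gradient at \<open>\<beta>s\<close> expresses its entries outside \<open>S\<close> through those on \<open>S\<close>; the incoherence
  condition keeps them strictly below \<open>\<tau>\<close>, the slack \<open>\<alpha>\<close> absorbing the gradient at \<open>\<beta>s\<close>
  and the remainder (\<open>strict_dual_feasibility\<close>).

  The negative gradient at \<open>b\<close> is then \<open>\<tau>\<close> times a subgradient of the \<open>\<ell>\<^sub>1\<close>-norm that is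
  strictly below one in modulus outside \<open>S\<close>. Convexity makes \<open>b\<close> a global minimizer, and strictness
  forces every other minimizer to vanish outside \<open>S\<close> (\<open>lasso_objective_lower_bound\<close>), where
  \<open>b\<close> is the only one.
\<close>

section \<open>Taylor expansion along a segment\<close>

lemma has_vector_derivative_along_line:
  fixes f :: "'a::real_normed_vector \<Rightarrow> 'b::real_normed_vector"
  assumes "f differentiable at (x + t *\<^sub>R v)"
  shows "((\<lambda>t. f (x + t *\<^sub>R v)) has_vector_derivative fderiv f (x + t *\<^sub>R v) v) (at t)"
proof -
  have "((\<lambda>t. x + t *\<^sub>R v) has_derivative (\<lambda>h. h *\<^sub>R v)) (at t)"
    by (auto intro!: derivative_eq_intros)
  then have "((\<lambda>t. f (x + t *\<^sub>R v)) has_derivative (\<lambda>h. fderiv f (x + t *\<^sub>R v) (h *\<^sub>R v))) (at t)"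
    by (rule has_derivative_compose[where g = f]) (rule has_derivative_fderiv[OF assms])
  then show ?thesis
    by (simp add: has_vector_derivative_def blinfun.scaleR_right)
qed

lemma DERIV_along_line:
  fixes f :: "'a::real_normed_vector \<Rightarrow> real"
  assumes "f differentiable at (x + t *\<^sub>R v)"
  shows "DERIV (\<lambda>t. f (x + t *\<^sub>R v)) t :> fderiv f (x + t *\<^sub>R v) v"
  using has_vector_derivative_along_line[OF assms]
  by (simp add: has_real_derivative_iff_has_vector_derivative)

lemma DERIV_fderiv_along_line:
  fixes f :: "'a::real_normed_vector \<Rightarrow> real"
  assumes "fderiv f differentiable at (x + t *\<^sub>R v)"
  shows "DERIV (\<lambda>t. fderiv f (x + t *\<^sub>R v) w) t :> fderiv2 f (x + t *\<^sub>R v) v w"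
  using bounded_linear.has_vector_derivative[OF blinfun.bounded_linear_left
      has_vector_derivative_along_line[OF assms], of w]
  by (simp add: has_real_derivative_iff_has_vector_derivative)

lemma DERIV_fderiv2_along_line:
  fixes f :: "'a::real_normed_vector \<Rightarrow> real"
  assumes "fderiv2 f differentiable at (x + t *\<^sub>R v)"
  shows "DERIV (\<lambda>t. fderiv2 f (x + t *\<^sub>R v) u w) t :> fderiv3 f (x + t *\<^sub>R v) v u w"
  using bounded_linear.has_vector_derivative[OF blinfun.bounded_linear_left
      bounded_linear.has_vector_derivative[OF blinfun.bounded_linear_left
        has_vector_derivative_along_line[OF assms]], of u w]
  by (simp add: has_real_derivative_iff_has_vector_derivative)

text \<open>The one-dimensional Taylor formula applied to \<open>t \<mapsto> fderiv f (x + t v) w\<close>. The direction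
  \<open>w\<close> stays the innermost argument throughout, so that the remainder has the form
  \<open>D\<^sup>3f[v,v,w]\<close> that the smoothness condition controls.\<close>

lemma taylor_fderiv:
  fixes f :: "'a::real_normed_vector \<Rightarrow> real"
  assumes C3: "C3_on f D" and seg: "\<And>t. 0 \<le> t \<Longrightarrow> t \<le> 1 \<Longrightarrow> x + t *\<^sub>R v \<in> D"
  obtains t where "0 < t" "t < 1"
    "fderiv f (x + v) w = fderiv f x w + fderiv2 f x v w + fderiv3 f (x + t *\<^sub>R v) v v w / 2"
proof -
  define d :: "nat \<Rightarrow> real \<Rightarrow> real" where
    "d m t = (if m = 0 then fderiv f (x + t *\<^sub>R v) w
       else if m = 1 then fderiv2 f (x + t *\<^sub>R v) v w else fderiv3 f (x + t *\<^sub>R v) v v w)" for m t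
  have "DERIV (d m) t :> d (Suc m) t" if m: "m < 2 \<and> 0 \<le> t \<and> t \<le> 1" for m t
  proof -
    have diff: "fderiv f differentiable at (x + t *\<^sub>R v)" "fderiv2 f differentiable at (x + t *\<^sub>R v)"
      using C3 seg[of t] m by (auto simp: C3_on_def)
    consider "m = 0" | "m = 1" using m by linarith
    then show ?thesis
      using DERIV_fderiv_along_line[OF diff(1), of w] DERIV_fderiv2_along_line[OF diff(2), of v w]
      by cases (auto simp: d_def[abs_def])
  qed
  then obtain t where "0 < t" "t < 1" "d 0 1 = (\<Sum>m<2. d m 0 / fact m * 1 ^ m) + d 2 t / fact 2 * 1\<^sup>2"
    using Maclaurin[of 1 2 d "d 0"] by auto
  then show ?thesis by (intro that[of t]) (auto simp: d_def numeral_2_eq_2)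
qed

lemma taylor_function:
  fixes f :: "'a::real_normed_vector \<Rightarrow> real"
  assumes C3: "C3_on f D" and seg: "\<And>t. 0 \<le> t \<Longrightarrow> t \<le> 1 \<Longrightarrow> x + t *\<^sub>R v \<in> D"
  obtains t where "0 < t" "t < 1"
    "f (x + v) = f x + fderiv f x v + fderiv2 f x v v / 2 + fderiv3 f (x + t *\<^sub>R v) v v v / 6"
proof -
  define d :: "nat \<Rightarrow> real \<Rightarrow> real" where
    "d m t = (if m = 0 then f (x + t *\<^sub>R v) else if m = 1 then fderiv f (x + t *\<^sub>R v) v
       else if m = 2 then fderiv2 f (x + t *\<^sub>R v) v v else fderiv3 f (x + t *\<^sub>R v) v v v)" for m t
  have "DERIV (d m) t :> d (Suc m) t" if m: "m < 3 \<and> 0 \<le> t \<and> t \<le> 1" for m t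
  proof -
    have diff: "f differentiable at (x + t *\<^sub>R v)"
      "fderiv f differentiable at (x + t *\<^sub>R v)" "fderiv2 f differentiable at (x + t *\<^sub>R v)"
      using C3 seg[of t] m by (auto simp: C3_on_def)
    consider "m = 0" | "m = 1" | "m = 2" using m by linarith
    then show ?thesis
      using DERIV_along_line[OF diff(1)] DERIV_fderiv_along_line[OF diff(2), of v]
        DERIV_fderiv2_along_line[OF diff(3), of v v]
      by cases (auto simp: d_def[abs_def])
  qed
  then obtain t where "0 < t" "t < 1" "d 0 1 = (\<Sum>m<3. d m 0 / fact m * 1 ^ m) + d 3 t / fact 3 * 1 ^ 3"
    using Maclaurin[of 1 3 d "d 0"] by auto
  then show ?thesis
    by (intro that[of t]) (auto simp: d_def numeral_2_eq_2 numeral_3_eq_3 lessThan_Suc fact_numeral)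
qed

section \<open>Symmetry of the second derivative\<close>

text \<open>The left-hand side of the final equation is symmetric in \<open>u\<close> and \<open>v\<close>, the right-hand side
  is not: this is what makes mixed derivatives commute. The mean value theorem is applied
  first to \<open>\<phi>\<close> in direction \<open>u\<close>, then to its derivative in direction \<open>v\<close>.\<close>

lemma second_difference_mean_value:
  fixes f :: "'a::real_normed_vector \<Rightarrow> real"
  assumes h: "h > 0"
    and diff: "\<And>s t. 0 \<le> s \<Longrightarrow> s \<le> h \<Longrightarrow> 0 \<le> t \<Longrightarrow> t \<le> h \<Longrightarrow>
      f differentiable at (x + s *\<^sub>R u + t *\<^sub>R v) \<and> fderiv f differentiable at (x + s *\<^sub>R u + t *\<^sub>R v)"
  obtains s t where "0 < s" "s < h" "0 < t" "t < h"
    "f (x + h *\<^sub>R u + h *\<^sub>R v) - f (x + h *\<^sub>R u) - f (x + h *\<^sub>R v) + f x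
       = h\<^sup>2 * fderiv2 f (x + s *\<^sub>R u + t *\<^sub>R v) v u"
proof -
  define \<phi> where "\<phi> s = f (x + h *\<^sub>R v + s *\<^sub>R u) - f (x + s *\<^sub>R u)" for s
  have "DERIV \<phi> s :> fderiv f (x + h *\<^sub>R v + s *\<^sub>R u) u - fderiv f (x + s *\<^sub>R u) u"
    if "0 \<le> s" "s \<le> h" for s
    unfolding \<phi>_def
    using diff[of s h] diff[of s 0] that h
    by (intro DERIV_diff DERIV_along_line) (auto simp: add_ac)
  from MVT2[OF h this] obtain s where s: "0 < s" "s < h"
    "\<phi> h - \<phi> 0 = h * (fderiv f (x + h *\<^sub>R v + s *\<^sub>R u) u - fderiv f (x + s *\<^sub>R u) u)"
    by auto
  have "DERIV (\<lambda>t. fderiv f (x + s *\<^sub>R u + t *\<^sub>R v) u) t :> fderiv2 f (x + s *\<^sub>R u + t *\<^sub>R v) v u"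
    if "0 \<le> t" "t \<le> h" for t
    using diff[of s t] that s by (intro DERIV_fderiv_along_line) auto
  from MVT2[OF h this] obtain t where t: "0 < t" "t < h"
    "fderiv f (x + s *\<^sub>R u + h *\<^sub>R v) u - fderiv f (x + s *\<^sub>R u) u
       = h * fderiv2 f (x + s *\<^sub>R u + t *\<^sub>R v) v u"
    by auto
  show ?thesis
    using s t by (intro that[of s t]) (auto simp: \<phi>_def add_ac power2_eq_square)
qed

text \<open>Evaluating the second difference over a small parallelogram in both orders shows that
  \<open>fderiv2 f y v u = fderiv2 f y' u v\<close> for points \<open>y\<close>, \<open>y'\<close> arbitrarily close to \<open>x\<close>; continuity
  at \<open>x\<close> does the rest.\<close>

lemma fderiv2_symmetric:
  fixes f :: "'a::real_normed_vector \<Rightarrow> real"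
  assumes U: "open U" "x \<in> U"
    and diff: "\<And>y. y \<in> U \<Longrightarrow> f differentiable at y \<and> fderiv f differentiable at y"
    and cont: "isCont (fderiv2 f) x"
  shows "fderiv2 f x u v = fderiv2 f x v u"
proof (rule ccontr)
  assume neq: "fderiv2 f x u v \<noteq> fderiv2 f x v u"
  define e where "e = \<bar>fderiv2 f x u v - fderiv2 f x v u\<bar> / 2"
  have e: "e > 0" using neq by (simp add: e_def)
  have "isCont (\<lambda>y. fderiv2 f y a b) x" for a b
    using cont by (intro continuous_intros)
  then have "\<forall>\<^sub>F y in nhds x. dist (fderiv2 f y a b) (fderiv2 f x a b) < e" for a b
    using e unfolding continuous_at_eps_delta eventually_nhds_metric by blast
  then have "\<forall>\<^sub>F y in nhds x. dist (fderiv2 f y u v) (fderiv2 f x u v) < e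
      \<and> dist (fderiv2 f y v u) (fderiv2 f x v u) < e \<and> y \<in> U"
    using U by (intro eventually_conj eventually_nhds_in_open) auto
  then obtain d where d: "d > 0" and near: "\<And>y. dist y x < d \<Longrightarrow>
      dist (fderiv2 f y u v) (fderiv2 f x u v) < e \<and> dist (fderiv2 f y v u) (fderiv2 f x v u) < e \<and> y \<in> U"
    unfolding eventually_nhds_metric by blast
  \<comment> \<open>The summand \<open>1\<close> keeps the denominator positive when \<open>u\<close> and \<open>v\<close> vanish.\<close>
  define h where "h = d / (norm u + norm v + 1)"
  have h: "h > 0" using d by (simp add: h_def add_nonneg_pos)
  have "h * (norm u + norm v + 1) = d"
    using norm_ge_zero[of u] norm_ge_zero[of v] by (simp add: h_def add_nonneg_eq_0_iff)
  then have hd: "h * (norm u + norm v) < d" using h by (simp add: algebra_simps)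
  have square: "dist (x + s *\<^sub>R u + t *\<^sub>R v) x < d"
    if "0 \<le> s" "s \<le> h" "0 \<le> t" "t \<le> h" for s t
  proof -
    have "norm (s *\<^sub>R u + t *\<^sub>R v) \<le> s * norm u + t * norm v"
      using norm_triangle_ineq[of "s *\<^sub>R u" "t *\<^sub>R v"] that by simp
    also have "\<dots> \<le> h * norm u + h * norm v"
      using that by (intro add_mono mult_right_mono) auto
    finally show ?thesis using hd by (simp add: dist_norm algebra_simps)
  qed
  have sq_diff: "f differentiable at (x + s *\<^sub>R u + t *\<^sub>R v) \<and> fderiv f differentiable at (x + s *\<^sub>R u + t *\<^sub>R v)"
    if "0 \<le> s" "s \<le> h" "0 \<le> t" "t \<le> h" for s t
    using diff near square[OF that] by blast
  have sq_diff': "f differentiable at (x + s *\<^sub>R v + t *\<^sub>R u) \<and> fderiv f differentiable at (x + s *\<^sub>R v + t *\<^sub>R u)"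
    if "0 \<le> s" "s \<le> h" "0 \<le> t" "t \<le> h" for s t
    using sq_diff[of t s] that by (simp add: add_ac)
  obtain s t where st: "0 < s" "s < h" "0 < t" "t < h"
    "f (x + h *\<^sub>R u + h *\<^sub>R v) - f (x + h *\<^sub>R u) - f (x + h *\<^sub>R v) + f x
       = h\<^sup>2 * fderiv2 f (x + s *\<^sub>R u + t *\<^sub>R v) v u"
    using second_difference_mean_value[OF h sq_diff] .
  obtain s' t' where st': "0 < s'" "s' < h" "0 < t'" "t' < h"
    "f (x + h *\<^sub>R v + h *\<^sub>R u) - f (x + h *\<^sub>R v) - f (x + h *\<^sub>R u) + f x
       = h\<^sup>2 * fderiv2 f (x + s' *\<^sub>R v + t' *\<^sub>R u) u v"
    using second_difference_mean_value[OF h sq_diff'] .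
  have swap: "x + a + b = x + b + a" for a b
    by (simp add: add_ac)
  have "h\<^sup>2 * fderiv2 f (x + s *\<^sub>R u + t *\<^sub>R v) v u = h\<^sup>2 * fderiv2 f (x + t' *\<^sub>R u + s' *\<^sub>R v) u v"
    using st(5) st'(5)
    unfolding swap[of "h *\<^sub>R v" "h *\<^sub>R u"] swap[of "s' *\<^sub>R v" "t' *\<^sub>R u"] by linarith
  then have "fderiv2 f (x + s *\<^sub>R u + t *\<^sub>R v) v u = fderiv2 f (x + t' *\<^sub>R u + s' *\<^sub>R v) u v"
    using h by simp
  then show False
    using near[OF square[of s t]] near[OF square[of t' s']] st st'
    unfolding e_def dist_real_def by (auto simp: abs_if split: if_splits)
qed

lemma hessian_symmetric:
  assumes "C3_on f D" "open D" "x \<in> D"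
  shows "transpose (hessian f x) = hessian f x"
proof -
  have "isCont (fderiv2 f) x"
    using assms by (intro differentiable_imp_continuous_within) (auto simp: C3_on_def)
  then have "fderiv2 f x u v = fderiv2 f x v u" for u v
    using assms by (intro fderiv2_symmetric[of D]) (auto simp: C3_on_def)
  then show ?thesis by (simp add: transpose_def hessian_def vec_eq_iff)
qed

lemma fderiv_axis: "fderiv f x (axis i 1) = gradient f x $ i"
  by (simp add: gradient_def riesz_def)

text \<open>The Taylor expansion of the gradient produces rows of the transposed Hessian, whereas the
  incoherence condition speaks of its rows; symmetry identifies them.\<close>

lemma fderiv2_axis_right:
  assumes "C3_on f D" "open D" "x \<in> D"
  shows "fderiv2 f x v (axis i 1) = (hessian f x *v v) $ i"
proof -
  have "fderiv2 f x v (axis i 1) = v \<bullet> (hessian f x *v axis i 1)"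
    by (simp add: inner_hessian)
  also have "\<dots> = (transpose (hessian f x) *v v) \<bullet> axis i 1"
    by (simp add: dot_lmul_matrix vector_transpose_matrix)
  finally show ?thesis
    using assms by (simp add: hessian_symmetric inner_axis)
qed

section \<open>The \<open>\<ell>\<^sub>1\<close>-norm and the smoothness condition\<close>

lemma infnorm_nth_le: "\<bar>(x :: real ^ 'n) $ i\<bar> \<le> infnorm x"
  using infnorm_le_iff[of x "infnorm x"] by simp

lemma abs_inner_le_infnorm_l1_norm: "\<bar>x \<bullet> w\<bar> \<le> infnorm x * l1_norm w"
proof -
  have "\<bar>x \<bullet> w\<bar> \<le> (\<Sum>i\<in>UNIV. \<bar>x $ i * w $ i\<bar>)"
    by (simp add: inner_vec_def)
  also have "\<dots> \<le> (\<Sum>i\<in>UNIV. infnorm x * \<bar>w $ i\<bar>)"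
    by (intro sum_mono) (auto simp: abs_mult intro!: mult_right_mono infnorm_nth_le)
  finally show ?thesis by (simp add: l1_norm_def sum_distrib_left)
qed

lemma l1_norm_axis [simp]: "l1_norm (axis i 1) = 1"
  by (simp add: l1_norm_def axis_def if_distrib cong: if_cong)

lemma l1_norm_nonneg: "0 \<le> l1_norm x"
  by (simp add: l1_norm_def sum_nonneg)

lemma l1_norm_triangle: "l1_norm (x + y) \<le> l1_norm x + l1_norm y"
  by (simp add: l1_norm_def flip: sum.distrib) (intro sum_mono abs_triangle_ineq)

lemma l1_norm_scaleR: "l1_norm (c *\<^sub>R x) = \<bar>c\<bar> * l1_norm x"
  by (simp add: l1_norm_def abs_mult sum_distrib_left)

lemma convex_on_l1_norm: "convex C \<Longrightarrow> convex_on C l1_norm"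
  unfolding convex_on_def
  by (metis abs_of_nonneg l1_norm_scaleR l1_norm_triangle)

lemma l1_norm_le_sqrt_card:
  assumes "\<forall>i\<in>- S. v $ i = 0"
  shows "l1_norm v \<le> sqrt (card S) * norm v"
proof -
  have "l1_norm v = (\<Sum>i\<in>S. \<bar>v $ i\<bar>)"
    unfolding l1_norm_def using assms by (intro sum.mono_neutral_right) auto
  then have "(l1_norm v)\<^sup>2 \<le> (\<Sum>i\<in>S. \<bar>v $ i\<bar>\<^sup>2) * card S"
    using sum_squared_le_sum_of_squares[of "\<lambda>i. \<bar>v $ i\<bar>" S] by simp
  also have "(\<Sum>i\<in>S. \<bar>v $ i\<bar>\<^sup>2) \<le> (norm v)\<^sup>2"
    unfolding norm_vec_def L2_set_def
    by (auto simp: sum_nonneg intro!: sum_mono2)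
  finally have "(l1_norm v)\<^sup>2 \<le> (norm v)\<^sup>2 * card S"
    by (simp add: mult_right_mono)
  then have "(l1_norm v)\<^sup>2 \<le> (sqrt (card S) * norm v)\<^sup>2"
    by (simp add: power_mult_distrib mult.commute)
  then show ?thesis by (rule power2_le_imp_le) simp
qed

text \<open>Hoelder's inequality turns the bound on the third derivative vector into one on the
  trilinear form. It is used with \<open>w = u\<close> for the objective and with \<open>w\<close> a unit vector for
  the gradient.\<close>

lemma LSSC_bound:
  assumes "LSSC f xs N K" "xs + \<delta> \<in> N" "\<forall>i\<in>- vsupp xs. u $ i = 0"
  shows "\<bar>fderiv3 f (xs + \<delta>) u u w\<bar> \<le> K * (norm u)\<^sup>2 * l1_norm w"
proof -
  have "\<bar>fderiv3 f (xs + \<delta>) u u w\<bar> \<le> infnorm (third_deriv_vec f (xs + \<delta>) u u) * l1_norm w"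
    using abs_inner_le_infnorm_l1_norm by (metis inner_third_deriv_vec)
  also have "\<dots> \<le> K * (norm u)\<^sup>2 * l1_norm w"
    using assms unfolding LSSC_def by (intro mult_right_mono l1_norm_nonneg) blast
  finally show ?thesis .
qed

section \<open>Blocks of a matrix\<close>

lemma submat_mult_vec:
  "submat I J A *v v = (\<chi> i. if i \<in> I then \<Sum>j\<in>J. A $ i $ j * v $ j else 0)"
  by (auto simp: vec_eq_iff matrix_vector_mult_def submat_def if_distrib if_distribR
      sum.If_cases cong: if_cong)

lemma submat_id_vec: "submat I I (mat 1) *v v = (\<chi> i. if i \<in> I then v $ i else 0)"
proof -
  have "(\<Sum>j\<in>I. mat 1 $ i $ j * v $ j) = v $ i" if "i \<in> I" for i
  proof -
    have "(\<Sum>j\<in>I. mat 1 $ i $ j * v $ j) = (\<Sum>j\<in>I. if j = i then v $ j else 0)"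
      by (intro sum.cong) (auto simp: mat_def)
    then show ?thesis using that by simp
  qed
  then show ?thesis by (simp add: submat_mult_vec vec_eq_iff)
qed

text \<open>\<open>submat S S (mat 1) *v v\<close> is the projection of \<open>v\<close> to the coordinates in \<open>S\<close>.\<close>

lemma loewner_lower_bound:
  assumes "loewner_le (c *\<^sub>R submat S S (mat 1)) (submat S S A)"
  shows "c * (norm (submat S S (mat 1) *v v))\<^sup>2 \<le> v \<bullet> (submat S S A *v v)"
proof -
  have "0 \<le> v \<bullet> ((submat S S A - c *\<^sub>R submat S S (mat 1)) *v v)"
    using assms by (simp add: loewner_le_def psd_def)
  then have "c * (v \<bullet> (submat S S (mat 1) *v v)) \<le> v \<bullet> (submat S S A *v v)"
    by (simp add: matrix_vector_mult_diff_rdistrib scaleR_matrix_vector_assoc[symmetric] inner_diff_right)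
  moreover have "v \<bullet> (submat S S (mat 1) *v v) = (norm (submat S S (mat 1) *v v))\<^sup>2"
    unfolding power2_norm_eq_inner submat_id_vec inner_vec_def by (intro sum.cong) auto
  ultimately show ?thesis by simp
qed

text \<open>With \<open>P\<close> the coordinate projection, the block extended by zero becomes the invertible
  matrix \<open>M\<close> once the identity is added on the complement of \<open>S\<close>. Since \<open>M\<close> commutes with \<open>P\<close>, so
  does its inverse, and cutting the inverse down by \<open>P\<close> inverts the block.\<close>

lemma is_block_inv_block_inv:
  fixes A :: "real ^ 'p ^ 'p"
  assumes c: "c > 0" and lower: "loewner_le (c *\<^sub>R submat S S (mat 1)) (submat S S A)"
  shows "is_block_inv S A (block_inv S A)"
proof -
  define P :: "real ^ 'p ^ 'p" where "P = submat S S (mat 1)"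
  define M where "M = submat S S A + (mat 1 - P)"
  have PP: "P ** P = P" by (simp add: P_def submat_id_mult)
  have PA: "P ** submat S S A = submat S S A" by (simp add: P_def submat_id_mult)
  have AP: "submat S S A ** P = submat S S A" by (simp add: P_def submat_mult_id)
  have PMP: "P ** M = submat S S A" "M ** P = submat S S A"
  proof -
    have "P *v (P *v x) = P *v x" "P *v (submat S S A *v x) = submat S S A *v x"
      "submat S S A *v (P *v x) = submat S S A *v x" for x
      by (simp_all add: matrix_vector_mul_assoc PP PA AP)
    then show "P ** M = submat S S A" "M ** P = submat S S A"
      by (simp_all add: matrix_eq M_def matrix_vector_mult_add_rdistrib matrix_vector_right_distrib
          matrix_vector_mult_diff_distrib matrix_vector_mult_diff_rdistrib
          flip: matrix_vector_mul_assoc)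
  qed
  have "v = 0" if "M *v v = 0" for v
  proof -
    have Pv: "submat S S A *v v + (v - P *v v) = 0"
      using that by (simp add: M_def matrix_vector_mult_add_rdistrib matrix_vector_mult_diff_rdistrib)
    have "P *v (M *v v) = submat S S A *v v"
      by (simp add: matrix_vector_mul_assoc PMP)
    then have A0: "submat S S A *v v = 0" using that by simp
    then have "c * (norm (P *v v))\<^sup>2 \<le> 0"
      using loewner_lower_bound[OF lower, of v] by (simp add: P_def)
    then have "P *v v = 0" using c by (simp add: mult_le_0_iff)
    then show "v = 0" using Pv A0 by simp
  qed
  then obtain B where BM: "B ** M = mat 1"
    using matrix_left_invertible_ker[of M] by blast
  then have MB: "M ** B = mat 1" by (simp add: matrix_left_right_inverse)
  define C where "C = P ** B ** P"
  have PB: "P ** B = B ** P"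
  proof -
    have "P ** B = B ** (M ** P) ** B" by (simp add: matrix_mul_assoc BM)
    also have "\<dots> = B ** (P ** M) ** B" by (simp only: PMP)
    also have "\<dots> = B ** P" by (simp add: MB flip: matrix_mul_assoc)
    finally show ?thesis .
  qed
  have "submat S S A ** C = P"
  proof -
    have "submat S S A ** C = M ** P ** (P ** B ** P)" by (simp only: C_def PMP)
    also have "\<dots> = M ** (P ** P) ** B ** P" by (simp add: matrix_mul_assoc)
    also have "\<dots> = M ** (P ** B) ** P" by (simp add: PP matrix_mul_assoc)
    also have "\<dots> = M ** B ** (P ** P)" by (simp only: PB matrix_mul_assoc)
    also have "\<dots> = P" by (simp add: MB PP)
    finally show ?thesis .
  qed
  moreover have "C ** submat S S A = P"
  proof -
    have "C ** submat S S A = P ** B ** P ** (P ** M)" by (simp only: C_def PMP)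
    also have "\<dots> = P ** B ** (P ** P) ** M" by (simp add: matrix_mul_assoc)
    also have "\<dots> = P ** (B ** P) ** M" by (simp add: PP matrix_mul_assoc)
    also have "\<dots> = P ** P ** (B ** M)" by (simp only: PB[symmetric] matrix_mul_assoc)
    also have "\<dots> = P" by (simp add: BM PP)
    finally show ?thesis .
  qed
  moreover have "submat S S C = C"
  proof -
    have "submat S S X = X" if "P ** X = X" "X ** P = X" for X :: "real ^ 'p ^ 'p"
    proof -
      have row: "X $ i $ j = 0" if "i \<notin> S" for i j
      proof -
        have "(P ** X) $ i $ j = 0" using that by (simp add: P_def submat_def matrix_matrix_mult_def)
        then show ?thesis by (simp add: \<open>P ** X = X\<close>)
      qed
      have col: "X $ i $ j = 0" if "j \<notin> S" for i j
      proof -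
        have "(X ** P) $ i $ j = 0" using that by (simp add: P_def submat_def matrix_matrix_mult_def)
        then show ?thesis by (simp add: \<open>X ** P = X\<close>)
      qed
      show ?thesis using row col by (auto simp: submat_def vec_eq_iff)
    qed
    moreover have "P ** C = C" by (simp add: C_def matrix_mul_assoc PP)
    moreover have "C ** P = C" by (simp add: C_def PP flip: matrix_mul_assoc)
    ultimately show ?thesis by blast
  qed
  ultimately have "is_block_inv S A C" by (simp add: is_block_inv_def P_def)
  then show ?thesis using block_inv_eq by metis
qed

lemma matrix_infnorm_bound:
  assumes "infnorm v \<le> m"
  shows "\<bar>(A *v v) $ i\<bar> \<le> matrix_infnorm A * m"
proof -
  have "\<bar>(A *v v) $ i\<bar> \<le> (\<Sum>j\<in>UNIV. \<bar>A $ i $ j * v $ j\<bar>)"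
    by (simp add: matrix_vector_mult_def)
  also have "\<dots> \<le> (\<Sum>j\<in>UNIV. \<bar>A $ i $ j\<bar> * m)"
    using assms by (intro sum_mono) (auto simp: abs_mult infnorm_le_iff intro!: mult_left_mono)
  also have "\<dots> = (\<Sum>j\<in>UNIV. \<bar>A $ i $ j\<bar>) * m" by (simp add: sum_distrib_right)
  also have "\<dots> \<le> matrix_infnorm A * m"
    using assms infnorm_pos_le[of v] unfolding matrix_infnorm_eq_row_sum
    by (intro mult_right_mono) auto
  finally show ?thesis .
qed

text \<open>On \<open>S\<close> the vector \<open>c = (A v)\<^sub>S\<close> determines \<open>v = B c\<close>, so the entries of \<open>A v\<close> outside
  \<open>S\<close> are the image of \<open>c\<close> under the matrix in the incoherence condition.\<close>

lemma off_block_bound: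
  assumes B: "is_block_inv S A B" and v: "\<forall>i\<in>- S. v $ i = 0"
    and m: "0 \<le> m" "\<And>j. j \<in> S \<Longrightarrow> \<bar>(A *v v) $ j\<bar> \<le> m" and i: "i \<notin> S"
  shows "\<bar>(A *v v) $ i\<bar> \<le> matrix_infnorm (submat (- S) S A ** B) * m"
proof -
  have Av: "(\<Sum>j\<in>S. A $ k $ j * v $ j) = (A *v v) $ k" for k
    unfolding matrix_vector_mult_def using v by (auto intro!: sum.mono_neutral_left)
  define c where "c = submat S S A *v v"
  have "infnorm c \<le> m"
    using m unfolding infnorm_le_iff c_def submat_mult_vec by (simp add: Av)
  moreover have "B *v c = v"
  proof -
    have "B *v c = submat S S (mat 1) *v v"
      using B by (simp add: c_def matrix_vector_mul_assoc is_block_inv_def)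
    also have "\<dots> = v" using v by (auto simp: submat_id_vec vec_eq_iff)
    finally show ?thesis .
  qed
  ultimately have "\<bar>(submat (- S) S A *v v) $ i\<bar> \<le> matrix_infnorm (submat (- S) S A ** B) * m"
    using matrix_infnorm_bound[of c m "submat (- S) S A ** B" i]
    by (simp flip: matrix_vector_mul_assoc)
  then show ?thesis using i by (simp add: submat_mult_vec Av)
qed

section \<open>Optimality for convex functions with an \<open>\<ell>\<^sub>1\<close>-penalty\<close>

lemma convex_on_above_tangent_plane:
  fixes f :: "'a::real_normed_vector \<Rightarrow> real"
  assumes D: "open D" and f: "convex_on D f" and x: "x \<in> D" and y: "y \<in> D"
    and diff: "f differentiable at x"
  shows "f x + fderiv f x (y - x) \<le> f y"
proof -
  define A where "A = {t. x + t *\<^sub>R (y - x) \<in> D}"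
  have comb: "x + (u * s + v * t) *\<^sub>R (y - x) = u *\<^sub>R (x + s *\<^sub>R (y - x)) + v *\<^sub>R (x + t *\<^sub>R (y - x))"
    if "u + v = 1" for u v s t :: real
  proof -
    have "u *\<^sub>R (x + s *\<^sub>R (y - x)) + v *\<^sub>R (x + t *\<^sub>R (y - x))
        = (u + v) *\<^sub>R x + (u * s + v * t) *\<^sub>R (y - x)"
      by (simp only: scaleR_add_right scaleR_add_left scaleR_scaleR add_ac)
    then show ?thesis using that by simp
  qed
  have "continuous_on UNIV (\<lambda>t. x + t *\<^sub>R (y - x))" by (intro continuous_intros)
  from open_vimage[OF D this] have "open A" by (simp add: A_def vimage_def)
  have conv: "convex_on A (\<lambda>t. f (x + t *\<^sub>R (y - x)))"
    using f unfolding convex_on_def convex_def A_def by (simp add: comb)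
  have "DERIV (\<lambda>t. f (x + t *\<^sub>R (y - x))) 0 :> fderiv f x (y - x)"
    using DERIV_along_line[of f x 0 "y - x"] diff by simp
  then have "fderiv f x (y - x) * (1 - 0)
      \<le> f (x + 1 *\<^sub>R (y - x)) - f (x + 0 *\<^sub>R (y - x))"
    using x y \<open>open A\<close> conv
    by (intro convex_on_imp_above_tangent[OF conv])
      (auto simp: A_def interior_open convex_on_def convex_connected intro: has_field_derivative_at_within)
  then show ?thesis by simp
qed

text \<open>A sufficient optimality condition with a quantitative surplus. The subgradient inequalities
  for \<open>L\<close> and for each modulus add up; in a coordinate outside \<open>S\<close> the penalty grows with
  slope \<open>\<tau>\<close>, of which the gradient can cancel only \<open>\<bar>gradient L x $ i\<bar>\<close>. If these
  differences are positive, another minimizer must vanish outside \<open>S\<close>.\<close>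

lemma lasso_objective_lower_bound:
  fixes L :: "real ^ 'p \<Rightarrow> real"
  assumes D: "open D" and L: "convex_on D L" and x: "x \<in> D" and y: "y \<in> D"
    and diff: "L differentiable at x" and \<tau>: "\<tau> \<ge> 0"
    and on: "\<And>i. i \<in> S \<Longrightarrow> gradient L x $ i = - \<tau> * sgn (x $ i)"
    and off: "\<And>i. i \<notin> S \<Longrightarrow> x $ i = 0"
  shows "L x + \<tau> * l1_norm x + (\<Sum>i\<in>- S. (\<tau> - \<bar>gradient L x $ i\<bar>) * \<bar>y $ i\<bar>)
    \<le> L y + \<tau> * l1_norm y"
proof -
  let ?g = "gradient L x"
  have coord: "\<tau> * \<bar>x $ i\<bar> + (if i \<in> - S then (\<tau> - \<bar>?g $ i\<bar>) * \<bar>y $ i\<bar> else 0)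
      \<le> ?g $ i * (y $ i - x $ i) + \<tau> * \<bar>y $ i\<bar>" for i
  proof (cases "i \<in> S")
    case True
    have "\<tau> * (sgn (x $ i) * y $ i) \<le> \<tau> * \<bar>y $ i\<bar>"
      using \<tau> by (intro mult_left_mono) (auto simp: sgn_if)
    then show ?thesis
      using True by (auto simp: on algebra_simps sgn_if split: if_splits)
  next
    case False
    have "- (\<bar>?g $ i\<bar> * \<bar>y $ i\<bar>) \<le> ?g $ i * y $ i"
      by (metis abs_ge_minus_self abs_mult minus_le_iff)
    then show ?thesis using False by (simp add: off algebra_simps)
  qed
  have "\<tau> * l1_norm x + (\<Sum>i\<in>- S. (\<tau> - \<bar>?g $ i\<bar>) * \<bar>y $ i\<bar>)
      = (\<Sum>i\<in>UNIV. \<tau> * \<bar>x $ i\<bar> + (if i \<in> - S then (\<tau> - \<bar>?g $ i\<bar>) * \<bar>y $ i\<bar> else 0))"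
    by (simp add: sum.distrib l1_norm_def sum_distrib_left sum.If_cases Compl_eq)
  also have "\<dots> \<le> (\<Sum>i\<in>UNIV. ?g $ i * (y $ i - x $ i) + \<tau> * \<bar>y $ i\<bar>)"
    by (intro sum_mono coord)
  also have "\<dots> = ?g \<bullet> (y - x) + \<tau> * l1_norm y"
    by (simp add: sum.distrib l1_norm_def sum_distrib_left inner_vec_def)
  also have "?g \<bullet> (y - x) = fderiv L x (y - x)"
    by (simp add: gradient_def inner_riesz)
  finally show ?thesis
    using convex_on_above_tangent_plane[OF D L x y diff] by linarith
qed

text \<open>Near a non-zero coordinate the penalty is linear in that coordinate, hence the objective is
  differentiable there and Fermat's rule applies.\<close>

lemma lasso_stationary_coordinate:
  fixes L :: "real ^ 'p \<Rightarrow> real"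
  assumes D: "open D" and x: "x \<in> D" and diff: "L differentiable at x" and xi: "x $ i \<noteq> 0"
    and min: "\<And>t. x + t *\<^sub>R axis i 1 \<in> D \<Longrightarrow>
      L x + \<tau> * l1_norm x \<le> L (x + t *\<^sub>R axis i 1) + \<tau> * l1_norm (x + t *\<^sub>R axis i 1)"
  shows "gradient L x $ i = - \<tau> * sgn (x $ i)"
proof -
  obtain e where e: "e > 0" "ball x e \<subseteq> D" using D x open_contains_ball by blast
  define d where "d = min e \<bar>x $ i\<bar>"
  define k where "k t = L (x + t *\<^sub>R axis i 1) + \<tau> * (sgn (x $ i) * t)" for t
  have "DERIV k 0 :> gradient L x $ i + \<tau> * sgn (x $ i)"
    unfolding k_def using DERIV_along_line[of L x 0 "axis i 1"] diff
    by (auto intro!: derivative_eq_intros simp: fderiv_axis)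
  moreover have "k 0 \<le> k t" if t: "\<bar>0 - t\<bar> < d" for t
  proof -
    have in_D: "x + t *\<^sub>R axis i 1 \<in> D"
      using e t by (auto simp: d_def dist_norm norm_axis_1)
    have "l1_norm (x + t *\<^sub>R axis i 1) = (\<Sum>j\<in>UNIV. \<bar>x $ j\<bar> + (if j = i then sgn (x $ i) * t else 0))"
      unfolding l1_norm_def
      using t by (intro sum.cong) (auto simp: axis_def d_def sgn_if abs_if split: if_splits)
    also have "\<dots> = l1_norm x + sgn (x $ i) * t"
      by (simp add: sum.distrib l1_norm_def)
    finally show ?thesis using min[OF in_D] by (simp add: k_def algebra_simps)
  qed
  moreover have "d > 0" using e xi by (simp add: d_def)
  ultimately have "gradient L x $ i + \<tau> * sgn (x $ i) = 0" by (blast intro: DERIV_local_min)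
  then show ?thesis by simp
qed

text \<open>If \<open>b\<close> were on or beyond the sphere, the segment from \<open>a\<close> to \<open>b\<close> would meet the sphere in a
  point where, by convexity, \<open>F\<close> is at most \<open>F a\<close>.\<close>

lemma convex_sublevel_inside_sphere:
  fixes F :: "'a::real_normed_vector \<Rightarrow> real"
  assumes F: "convex_on C F" and a: "a \<in> C" and b: "b \<in> C" and le: "F b \<le> F a" and r: "r > 0"
    and sphere: "\<And>y. y \<in> C \<Longrightarrow> norm (y - a) = r \<Longrightarrow> F a < F y"
  shows "norm (b - a) < r"
proof (rule ccontr)
  assume "\<not> norm (b - a) < r"
  then have nb: "norm (b - a) \<ge> r" by simp
  define t where "t = r / norm (b - a)"
  have t: "0 \<le> t" "t \<le> 1" using r nb by (auto simp: t_def divide_le_eq)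
  define y where "y = (1 - t) *\<^sub>R a + t *\<^sub>R b"
  have "y - a = t *\<^sub>R (b - a)" by (simp add: y_def algebra_simps)
  then have "norm (y - a) = r" using r nb by (auto simp: t_def)
  moreover have "y \<in> C"
    using F a b t unfolding convex_on_def y_def by (simp add: convexD)
  moreover have "F y \<le> (1 - t) * F a + t * F b"
    using F a b t unfolding convex_on_def y_def by simp
  moreover have "(1 - t) * F a + t * F b \<le> F a"
    using mult_left_mono[OF le t(1)] by (simp add: algebra_simps)
  ultimately show False using sphere by fastforce
qed

section \<open>The two quantitative estimates\<close>

text \<open>With \<open>n = l1_norm v\<close>, the gradient costs at most \<open>\<alpha> / 4 * \<tau> * n\<close>, the remainder a sixth of
  that, and the penalty \<open>\<tau> * n\<close>, where \<open>n \<le> sqrt s * r\<close>. The gain is \<open>lam * r\<^sup>2 / 2\<close>, which is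
  \<open>(\<alpha> / 2 + 2) * \<tau> * sqrt s * r\<close> and so exceeds the total cost, at most
  \<open>(\<alpha> / 4 + \<alpha> / 24 + 1) * \<tau> * sqrt s * r\<close>.\<close>

lemma lasso_objective_larger_on_sphere:
  fixes L :: "real ^ 'p \<Rightarrow> real"
  assumes C3: "C3_on L D" and seg: "\<And>t. 0 \<le> t \<Longrightarrow> t \<le> 1 \<Longrightarrow> x + t *\<^sub>R v \<in> D"
    and v: "\<forall>i\<in>- S. v $ i = 0" "norm v = r" and card: "card S \<le> s"
    and pos: "r > 0" "lam > 0" "\<tau> > 0" "\<alpha> > 0"
    and grad: "infnorm (gradient L x) \<le> \<alpha> / 4 * \<tau>"
    and curv: "lam * r\<^sup>2 \<le> fderiv2 L x v v"
    and third: "\<And>t. 0 \<le> t \<Longrightarrow> t \<le> 1 \<Longrightarrow> \<bar>fderiv3 L (x + t *\<^sub>R v) v v v\<bar> \<le> K * r\<^sup>2 * l1_norm v"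
    and small: "K * r\<^sup>2 < \<alpha> / 4 * \<tau>"
    and r_def: "lam * r = (\<alpha> + 4) * (sqrt (real s) * \<tau>)"
  shows "L x + \<tau> * l1_norm x < L (x + v) + \<tau> * l1_norm (x + v)"
proof -
  obtain t where t: "0 < t" "t < 1"
    "L (x + v) = L x + fderiv L x v + fderiv2 L x v v / 2 + fderiv3 L (x + t *\<^sub>R v) v v v / 6"
    using taylor_function[OF C3 seg] by blast
  have "\<bar>fderiv L x v\<bar> \<le> infnorm (gradient L x) * l1_norm v"
    using abs_inner_le_infnorm_l1_norm[of "gradient L x" v] by (simp add: gradient_def inner_riesz)
  also have "\<dots> \<le> \<alpha> / 4 * \<tau> * l1_norm v"
    by (intro mult_right_mono grad l1_norm_nonneg)
  finally have first: "- (\<alpha> / 4 * \<tau> * l1_norm v) \<le> fderiv L x v" by linarith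
  have "\<bar>fderiv3 L (x + t *\<^sub>R v) v v v\<bar> \<le> K * r\<^sup>2 * l1_norm v"
    using third t by simp
  also have "\<dots> \<le> \<alpha> / 4 * \<tau> * l1_norm v"
    using small by (intro mult_right_mono l1_norm_nonneg) simp
  finally have rem: "- (\<alpha> / 4 * \<tau> * l1_norm v) \<le> fderiv3 L (x + t *\<^sub>R v) v v v" by linarith
  have "l1_norm x \<le> l1_norm (x + v) + l1_norm v"
    using l1_norm_triangle[of "x + v" "- 1 *\<^sub>R v"] l1_norm_scaleR[of "- 1" v] by simp
  then have pen: "\<tau> * l1_norm x \<le> \<tau> * l1_norm (x + v) + \<tau> * l1_norm v"
    using pos by (simp flip: distrib_left)
  define q where "q = sqrt (real s) * \<tau>"
  have "0 < (\<alpha> + 4) * q" using pos r_def unfolding q_def by (metis mult_pos_pos)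
  then have q: "q > 0" using pos by (simp add: zero_less_mult_iff)
  have "\<tau> * l1_norm v \<le> \<tau> * (sqrt (card S) * r)"
    using l1_norm_le_sqrt_card[OF v(1)] v(2) pos by (intro mult_left_mono) auto
  also have "\<dots> \<le> \<tau> * (sqrt (real s) * r)"
    using card pos by (intro mult_left_mono mult_right_mono) auto
  finally have l1: "\<tau> * l1_norm v \<le> r * q" by (simp add: q_def mult_ac)
  have "(\<alpha> / 4 + \<alpha> / 24 + 1) * (\<tau> * l1_norm v) \<le> (\<alpha> / 4 + \<alpha> / 24 + 1) * (r * q)"
    using l1 pos by (intro mult_left_mono) auto
  also have "\<dots> < (\<alpha> + 4) / 2 * (r * q)"
    using pos q by (intro mult_strict_right_mono) auto
  also have "\<dots> = lam * r\<^sup>2 / 2"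
    using r_def by (simp add: q_def power2_eq_square)
  finally have "\<alpha> / 4 * \<tau> * l1_norm v + \<alpha> / 4 * \<tau> * l1_norm v / 6 + \<tau> * l1_norm v < lam * r\<^sup>2 / 2"
    by (simp add: algebra_simps)
  then show ?thesis using t(3) first rem pen curv by linarith
qed

text \<open>The gradient at \<open>x + v\<close> differs from \<open>H v\<close>, with \<open>H\<close> the Hessian at \<open>x\<close>, by at most
  \<open>(\<alpha> / 4 + \<alpha> / 8) * \<tau>\<close> in each entry: the gradient at \<open>x\<close> and half the third-derivative term. So the
  entries of \<open>H v\<close> on \<open>S\<close> are at most \<open>m = \<tau> + 3 * \<alpha> / 8 * \<tau>\<close>, those outside \<open>S\<close> less than
  \<open>(1 - \<alpha>) * m\<close>, and returning to the gradient adds another \<open>3 * \<alpha> / 8 * \<tau>\<close>. What is left below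
  \<open>\<tau>\<close> is at least \<open>\<alpha> * \<tau> / 4\<close>.\<close>

lemma strict_dual_feasibility:
  fixes L :: "real ^ 'p \<Rightarrow> real"
  assumes C3: "C3_on L D" and D: "open D" and seg: "\<And>t. 0 \<le> t \<Longrightarrow> t \<le> 1 \<Longrightarrow> x + t *\<^sub>R v \<in> D"
    and v: "\<forall>i\<in>- S. v $ i = 0"
    and B: "is_block_inv S (hessian L x) B" and \<alpha>: "\<alpha> > 0"
    and incoherence: "matrix_infnorm (submat (- S) S (hessian L x) ** B) < 1 - \<alpha>"
    and grad: "infnorm (gradient L x) \<le> \<alpha> / 4 * \<tau>" and \<tau>: "\<tau> > 0"
    and third: "\<And>t i. 0 \<le> t \<Longrightarrow> t \<le> 1 \<Longrightarrow> \<bar>fderiv3 L (x + t *\<^sub>R v) v v (axis i 1)\<bar> \<le> \<alpha> / 4 * \<tau>"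
    and stationary: "\<And>j. j \<in> S \<Longrightarrow> \<bar>gradient L (x + v) $ j\<bar> \<le> \<tau>"
    and i: "i \<notin> S"
  shows "\<bar>gradient L (x + v) $ i\<bar> < \<tau>"
proof -
  let ?H = "hessian L x"
  have x: "x \<in> D" using seg[of 0] by simp
  have close: "\<bar>gradient L (x + v) $ j - (?H *v v) $ j\<bar> \<le> 3 * \<alpha> / 8 * \<tau>" for j
  proof -
    obtain t where t: "0 < t" "t < 1"
      "fderiv L (x + v) (axis j 1) = fderiv L x (axis j 1) + fderiv2 L x v (axis j 1)
         + fderiv3 L (x + t *\<^sub>R v) v v (axis j 1) / 2"
      using taylor_fderiv[OF C3 seg] by blast
    have "\<bar>fderiv3 L (x + t *\<^sub>R v) v v (axis j 1)\<bar> \<le> \<alpha> / 4 * \<tau>" using third t by simp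
    moreover have "\<bar>gradient L x $ j\<bar> \<le> \<alpha> / 4 * \<tau>" using grad infnorm_le_iff by blast
    moreover have "gradient L (x + v) $ j - (?H *v v) $ j
        = gradient L x $ j + fderiv3 L (x + t *\<^sub>R v) v v (axis j 1) / 2"
      using t(3) by (simp add: fderiv_axis fderiv2_axis_right[OF C3 D x])
    ultimately show ?thesis by linarith
  qed
  define m where "m = \<tau> + 3 * \<alpha> / 8 * \<tau>"
  have m: "m > 0" using \<alpha> \<tau> by (simp add: m_def add_pos_pos)
  have "\<bar>(?H *v v) $ j\<bar> \<le> m" if "j \<in> S" for j
    using close[of j] stationary[OF that] unfolding m_def by linarith
  then have "\<bar>(?H *v v) $ i\<bar> \<le> matrix_infnorm (submat (- S) S ?H ** B) * m"
    using off_block_bound[OF B v _ _ i] m by simp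
  also have "\<dots> < (1 - \<alpha>) * m"
    using incoherence m by (rule mult_strict_right_mono)
  finally have "\<bar>gradient L (x + v) $ i\<bar> < 3 * \<alpha> / 8 * \<tau> + (1 - \<alpha>) * m"
    using close[of i] by linarith
  also have "\<dots> = \<tau> - \<alpha> * \<tau> / 4 - 3 * \<alpha>\<^sup>2 / 8 * \<tau>"
    by (simp add: m_def field_simps power2_eq_square)
  also have "\<dots> \<le> \<tau>"
  proof -
    have "0 \<le> \<alpha> * \<tau> / 4" "0 \<le> 3 * \<alpha>\<^sup>2 / 8 * \<tau>" using \<alpha> \<tau> by simp_all
    then show ?thesis by linarith
  qed
  finally show ?thesis .
qed

section \<open>Sign consistency of the lasso\<close>

text \<open>By the choice of \<open>r\<close>, the upper bound on \<open>\<tau>\<close> says that \<open>K * r\<^sup>2 < \<alpha> / 4 * \<tau>\<close>: per unit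
  of \<open>\<ell>\<^sub>1\<close>-norm, the third derivative on the ball of radius \<open>r\<close> is no larger than the tolerated
  gradient at \<open>\<beta>s\<close>. Both quantitative estimates rest on this.\<close>

theorem theorem5p1:
  fixes \<beta>s :: "real ^ 'p" and S :: "'p set" and s :: nat
    and L :: "real ^ 'p \<Rightarrow> real" and D N :: "(real ^ 'p) set"
    and \<tau> lam \<alpha> K r :: real
  assumes S_def: "S = vsupp \<beta>s"
    and sparse: "card S \<le> s"
    and \<tau>_pos: "\<tau> > 0"
    and restricted_minimizer:
      "\<exists>!\<beta>. is_arg_min (\<lambda>\<beta>. L \<beta> + \<tau> * l1_norm \<beta>) (\<lambda>\<beta>. \<beta> \<in> D \<and> (\<forall>i\<in>- S. \<beta> $ i = 0)) \<beta>"
    and lam_pos: "lam > 0"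
    and \<alpha>: "0 < \<alpha>" "\<alpha> \<le> 1"
    and K_nonneg: "K \<ge> 0"
    and r_def: "r = (\<alpha> + 4) / lam * sqrt (real s) * \<tau>"
    and open_D: "open D"
    and convex_L: "convex_on D L"
    and C3_L: "C3_on L D"
    and N: "open N" "convex N" "N \<subseteq> D" "\<beta>s \<in> N"
    and lssc: "LSSC L \<beta>s N K"
    and hessian_lower: "loewner_le (lam *\<^sub>R submat S S (mat 1)) (submat S S (hessian L \<beta>s))"
    and incoherence:
      "matrix_infnorm (submat (- S) S (hessian L \<beta>s) ** block_inv S (hessian L \<beta>s)) < 1 - \<alpha>"
    and beta_min: "\<forall>k\<in>S. \<bar>\<beta>s $ k\<bar> > r"
    and \<tau>_bound:
      "K * real s \<noteq> 0 \<longrightarrow> \<tau> < lam\<^sup>2 / (4 * (\<alpha> + 4)\<^sup>2) * (\<alpha> / (K * real s))"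
    and gradient_bound: "infnorm (gradient L \<beta>s) \<le> \<alpha> / 4 * \<tau>"
    and ball_in_N: "{\<beta>. norm (\<beta> - \<beta>s) \<le> r \<and> (\<forall>i\<in>- S. \<beta> $ i = 0)} \<subseteq> N"
  shows "(\<exists>!\<beta>. is_arg_min (\<lambda>\<beta>. L \<beta> + \<tau> * l1_norm \<beta>) (\<lambda>\<beta>. \<beta> \<in> D) \<beta>) \<and>
    (\<forall>\<beta>h. is_arg_min (\<lambda>\<beta>. L \<beta> + \<tau> * l1_norm \<beta>) (\<lambda>\<beta>. \<beta> \<in> D) \<beta>h \<longrightarrow>
       sign_vec \<beta>h = sign_vec \<beta>s \<and> norm (\<beta>h - \<beta>s) \<le> r)"
proof -
  define F where "F \<beta> = L \<beta> + \<tau> * l1_norm \<beta>" for \<beta>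
  define C where "C = D \<inter> {\<beta>. \<forall>i\<in>- S. \<beta> $ i = 0}"
  obtain b where b: "is_arg_min F (\<lambda>\<beta>. \<beta> \<in> D \<and> (\<forall>i\<in>- S. \<beta> $ i = 0)) b"
    and b_unique: "\<And>\<beta>. is_arg_min F (\<lambda>\<beta>. \<beta> \<in> D \<and> (\<forall>i\<in>- S. \<beta> $ i = 0)) \<beta> \<Longrightarrow> \<beta> = b"
    using restricted_minimizer unfolding F_def[abs_def] by blast
  have bC: "b \<in> C" and b_min: "\<And>\<beta>. \<beta> \<in> C \<Longrightarrow> F b \<le> F \<beta>"
    using b by (auto simp: C_def is_arg_min_linorder)
  have bsC: "\<beta>s \<in> C" using N by (auto simp: C_def S_def vsupp_def)
  have "convex {\<beta> :: real ^ 'p. \<forall>i\<in>- S. \<beta> $ i = 0}" by (simp add: convex_def)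
  then have "convex C" using convex_L by (auto simp: C_def convex_on_def intro: convex_Int)
  then have F_convex: "convex_on C F"
    unfolding F_def[abs_def] using \<tau>_pos convex_L
    by (intro convex_on_add convex_on_cmul convex_on_l1_norm)
      (auto intro: convex_on_subset simp: C_def)
  define v where "v = b - \<beta>s"
  have v: "\<forall>i\<in>- S. v $ i = 0" and b_eq: "b = \<beta>s + v"
    using bC bsC by (auto simp: C_def v_def)
  have r_nonneg: "r \<ge> 0" unfolding r_def using \<alpha> lam_pos \<tau>_pos by simp
  have lam_r: "lam * r = (\<alpha> + 4) * (sqrt (real s) * \<tau>)"
    unfolding r_def using lam_pos by simp

  have small: "K * r\<^sup>2 < \<alpha> / 4 * \<tau>"
  proof (cases "K * real s = 0")
    case True
    then have "K * r\<^sup>2 = 0" by (auto simp: r_def)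
    moreover have "0 < \<alpha> / 4 * \<tau>" using \<alpha> \<tau>_pos by simp
    ultimately show ?thesis by linarith
  next
    case False
    then have Ks: "K * real s > 0" using K_nonneg mult_nonneg_nonneg[of K "real s"] by linarith
    \<comment> \<open>\<open>c = K * r\<^sup>2 / \<tau>\<close>, written so that the bound on \<open>\<tau>\<close> applies to its last factor\<close>
    define c where "c = K * real s * (\<alpha> + 4)\<^sup>2 / lam\<^sup>2 * \<tau>"
    have "K * r\<^sup>2 = c * \<tau>"
      by (simp add: r_def c_def power_mult_distrib power_divide power2_eq_square[of \<tau>])
    moreover have "c < \<alpha> / 4"
    proof -
      have "\<tau> < lam\<^sup>2 / (4 * (\<alpha> + 4)\<^sup>2) * (\<alpha> / (K * real s))" using \<tau>_bound False by blast
      then have "c < K * real s * (\<alpha> + 4)\<^sup>2 / lam\<^sup>2 * (lam\<^sup>2 / (4 * (\<alpha> + 4)\<^sup>2) * (\<alpha> / (K * real s)))"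
        unfolding c_def using Ks \<alpha>(1) lam_pos
        by (intro mult_strict_left_mono divide_pos_pos mult_pos_pos[OF Ks]) auto
      also have "\<dots> = \<alpha> / 4" using False \<alpha>(1) lam_pos by (simp add: field_simps)
      finally show ?thesis .
    qed
    ultimately show ?thesis using \<tau>_pos by simp
  qed

  have seg_N: "\<beta>s + t *\<^sub>R w \<in> N"
    if "\<forall>i\<in>- S. w $ i = 0" "norm w \<le> r" "0 \<le> t" "t \<le> 1" for t w
  proof -
    have "norm (t *\<^sub>R w) \<le> r"
      using mult_mono[of t 1 "norm w" r] that by simp
    moreover have "\<beta>s $ i = 0" if "i \<in> - S" for i using that by (simp add: S_def vsupp_def)
    ultimately show ?thesis using ball_in_N that by auto
  qed
  have third: "\<bar>fderiv3 L (\<beta>s + t *\<^sub>R w) w w z\<bar> \<le> K * (norm w)\<^sup>2 * l1_norm z"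
    if "\<forall>i\<in>- S. w $ i = 0" "norm w \<le> r" "0 \<le> t" "t \<le> 1" for t w z
    using LSSC_bound[OF lssc seg_N[OF that]] that(1) by (simp add: S_def)
  have curv: "lam * (norm w)\<^sup>2 \<le> fderiv2 L \<beta>s w w" if w: "\<forall>i\<in>- S. w $ i = 0" for w
  proof -
    have "submat S S (mat 1) *v w = w" using w by (auto simp: submat_id_vec vec_eq_iff)
    moreover have "w \<bullet> (submat S S (hessian L \<beta>s) *v w) = w \<bullet> (hessian L \<beta>s *v w)"
    proof -
      have "(\<Sum>j\<in>S. hessian L \<beta>s $ i $ j * w $ j) = (hessian L \<beta>s *v w) $ i" for i
        unfolding matrix_vector_mult_def using w by (auto intro!: sum.mono_neutral_left)
      then show ?thesis
        unfolding submat_mult_vec inner_vec_def using w by (intro sum.cong) auto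
    qed
    ultimately show ?thesis
      using loewner_lower_bound[OF hessian_lower, of w] by (simp add: inner_hessian)
  qed

  have error: "norm v \<le> r"
  proof (cases "r = 0")
    case True
    \<comment> \<open>There is no sphere of radius zero, but then \<open>S\<close> is empty and the only competitor is zero.\<close>
    then have "s = 0" using \<alpha> lam_pos \<tau>_pos by (auto simp: r_def)
    then have "S = {}" using sparse by simp
    then have "v = 0" using v by (simp add: vec_eq_iff)
    then show ?thesis using True by simp
  next
    case False
    then have r: "r > 0" using r_nonneg by simp
    have "F \<beta>s < F y" if y: "y \<in> C" "norm (y - \<beta>s) = r" for y
    proof -
      have w: "\<forall>i\<in>- S. (y - \<beta>s) $ i = 0" using y(1) bsC by (auto simp: C_def)
      have "F \<beta>s < L (\<beta>s + (y - \<beta>s)) + \<tau> * l1_norm (\<beta>s + (y - \<beta>s))"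
        unfolding F_def
      proof (rule lasso_objective_larger_on_sphere[OF C3_L _ w y(2) sparse r lam_pos \<tau>_pos \<alpha>(1)
              gradient_bound _ _ small lam_r])
        show "\<beta>s + t *\<^sub>R (y - \<beta>s) \<in> D" if "0 \<le> t" "t \<le> 1" for t
          using seg_N[OF w _ that] y(2) N(3) by auto
        show "lam * r\<^sup>2 \<le> fderiv2 L \<beta>s (y - \<beta>s) (y - \<beta>s)"
          using curv[OF w] y(2) by simp
        show "\<bar>fderiv3 L (\<beta>s + t *\<^sub>R (y - \<beta>s)) (y - \<beta>s) (y - \<beta>s) (y - \<beta>s)\<bar>
            \<le> K * r\<^sup>2 * l1_norm (y - \<beta>s)" if "0 \<le> t" "t \<le> 1" for t
          using third[OF w _ that] y(2) by simp
      qed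
      then show ?thesis by (simp add: F_def)
    qed
    then show ?thesis
      using convex_sublevel_inside_sphere[OF F_convex bsC bC b_min[OF bsC] r] by (simp add: v_def)
  qed

  have sgn_eq: "sgn (b $ k) = sgn (\<beta>s $ k)" for k
  proof (cases "k \<in> S")
    case True
    have "\<bar>v $ k\<bar> < \<bar>\<beta>s $ k\<bar>"
      using component_le_norm_cart[of v k] error beta_min True by fastforce
    then show ?thesis by (auto simp: b_eq sgn_if)
  next
    case False
    then show ?thesis using bC bsC by (simp add: C_def)
  qed
  have b_nz: "b $ k \<noteq> 0" if "k \<in> S" for k
    using that sgn_eq[of k] by (auto simp: S_def vsupp_def sgn_zero_iff)

  have bD: "b \<in> D" using bC by (simp add: C_def)
  have diff: "L differentiable at b" using C3_L bD by (simp add: C3_on_def)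
  have stationary: "gradient L b $ k = - \<tau> * sgn (b $ k)" if k: "k \<in> S" for k
  proof (rule lasso_stationary_coordinate[OF open_D bD diff b_nz[OF k]])
    fix t assume "b + t *\<^sub>R axis k 1 \<in> D"
    then have "b + t *\<^sub>R axis k 1 \<in> C" using bC k by (auto simp: C_def axis_def)
    then show "L b + \<tau> * l1_norm b \<le> L (b + t *\<^sub>R axis k 1) + \<tau> * l1_norm (b + t *\<^sub>R axis k 1)"
      using b_min by (simp add: F_def)
  qed

  have dual: "\<bar>gradient L b $ i\<bar> < \<tau>" if i: "i \<notin> S" for i
    unfolding b_eq
  proof (rule strict_dual_feasibility[OF C3_L open_D _ v _ \<alpha>(1) incoherence gradient_bound \<tau>_pos _ _ i])
    show "is_block_inv S (hessian L \<beta>s) (block_inv S (hessian L \<beta>s))"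
      by (rule is_block_inv_block_inv[OF lam_pos hessian_lower])
    show "\<beta>s + t *\<^sub>R v \<in> D" if "0 \<le> t" "t \<le> 1" for t
      using seg_N[OF v error that] N by blast
    show "\<bar>fderiv3 L (\<beta>s + t *\<^sub>R v) v v (axis i 1)\<bar> \<le> \<alpha> / 4 * \<tau>" if "0 \<le> t" "t \<le> 1" for t i
    proof -
      have "K * (norm v)\<^sup>2 \<le> K * r\<^sup>2"
        using error K_nonneg by (intro mult_left_mono power_mono) auto
      then show ?thesis using third[OF v error that, of "axis i 1"] small by simp
    qed
    show "\<bar>gradient L (\<beta>s + v) $ j\<bar> \<le> \<tau>" if "j \<in> S" for j
      using stationary[OF that] \<tau>_pos by (simp add: b_eq abs_mult abs_sgn_eq)
  qed

  have lower: "F b + (\<Sum>i\<in>- S. (\<tau> - \<bar>gradient L b $ i\<bar>) * \<bar>y $ i\<bar>) \<le> F y" if "y \<in> D" for y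
    using lasso_objective_lower_bound[OF open_D convex_L bD that diff _ stationary, of S] bC \<tau>_pos
    by (simp add: F_def C_def)
  have gap: "0 \<le> (\<tau> - \<bar>gradient L b $ i\<bar>) * \<bar>y $ i\<bar>" if "i \<in> - S" for i y
    using dual[of i] that by simp
  have gap_sum: "0 \<le> (\<Sum>i\<in>- S. (\<tau> - \<bar>gradient L b $ i\<bar>) * \<bar>y $ i\<bar>)" for y
    by (intro sum_nonneg gap)
  have global: "F b \<le> F y" if "y \<in> D" for y
    using lower[OF that] gap_sum[of y] by linarith
  have unique: "\<beta> = b" if \<beta>: "is_arg_min F (\<lambda>\<beta>. \<beta> \<in> D) \<beta>" for \<beta>
  proof -
    have \<beta>D: "\<beta> \<in> D" and le: "\<And>y. y \<in> D \<Longrightarrow> F \<beta> \<le> F y"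
      using \<beta> by (auto simp: is_arg_min_linorder)
    have "(\<Sum>i\<in>- S. (\<tau> - \<bar>gradient L b $ i\<bar>) * \<bar>\<beta> $ i\<bar>) = 0"
      using lower[OF \<beta>D] le[OF bD] gap_sum[of \<beta>] by linarith
    then have "\<forall>i\<in>- S. (\<tau> - \<bar>gradient L b $ i\<bar>) * \<bar>\<beta> $ i\<bar> = 0"
      using gap[of _ \<beta>] by (subst (asm) sum_nonneg_eq_0_iff) auto
    then have "\<forall>i\<in>- S. \<beta> $ i = 0" using dual by fastforce
    then show "\<beta> = b"
      using \<beta>D le by (intro b_unique) (auto simp: is_arg_min_linorder)
  qed
  have "is_arg_min F (\<lambda>\<beta>. \<beta> \<in> D) b"
    using bD global by (auto simp: is_arg_min_linorder)
  moreover have "sign_vec b = sign_vec \<beta>s"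
    by (simp add: sign_vec_def sgn_eq)
  moreover have "norm (b - \<beta>s) \<le> r" using error by (simp add: v_def)
  ultimately have "(\<exists>!\<beta>. is_arg_min F (\<lambda>\<beta>. \<beta> \<in> D) \<beta>) \<and>
    (\<forall>\<beta>h. is_arg_min F (\<lambda>\<beta>. \<beta> \<in> D) \<beta>h \<longrightarrow> sign_vec \<beta>h = sign_vec \<beta>s \<and> norm (\<beta>h - \<beta>s) \<le> r)"
    using unique by blast
  then show ?thesis unfolding F_def[abs_def] .
qed

end
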